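(* Let $G$ be a graph of order $n$, and let $D=\{C_1,C_2,\ldots,C_s\}$ be a clique decomposition of the complement $G^c$ of $G$, with $s\geq 2$. Then $$drn(G)\leq s(n+1)-\sum_{i=1}^{s}p(C_i).$$
   Context: All graphs are finite, simple and undirected. $p(H)$ denotes the order (number of vertices) of a graph $H$. A clique decomposition of a graph $H$ is a collection of non-trivial cliques of $H$ (complete subgraphs with at least two vertices) which partition the edge set of $H$, i.e. every edge of $H$ lies in exactly one clique of the collection. For a positive integer $k$, $[k]=\{1,\dots,k\}$ and $S_k$ is the group of permutations of $[k]$. A derangement $k$-representation of a graph $G$ is an injective map $\pi:V(G)\to S_k$ such that for any two distinct vertices $u,v$ of $G$, $u$ and $v$ are adjacent if and only if $\pi(v)(i)\neq\pi(u)(i)$ for all $i\in[k]$. The derangement representation number $drn(G)$ is the minimum $k$ such that $G$ has a derangement $k$-representation. (An assertion $drn(G)\le N$ includes the assertion that such a $k$ exists.) *)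

theory Defs
  imports "Graph_Theory.Graph_Theory" "HOL-Combinatorics.Permutations"
begin

text \<open>
  Finite simple undirected graphs are those satisfying \<^locale>\<open>pair_graph\<close>: finite, loopless and
  with a symmetric set of arcs, an undirected edge \<open>uv\<close> being the two arcs \<open>(u, v)\<close> and \<open>(v, u)\<close>.
\<close>

definition graph_complement :: "'a pair_pre_digraph \<Rightarrow> 'a pair_pre_digraph" where
  "graph_complement G =
     \<lparr> pverts = pverts G,
       parcs = {(u, v). u \<in> pverts G \<and> v \<in> pverts G \<and> u \<noteq> v \<and> (u, v) \<notin> parcs G} \<rparr>"

definition nontrivial_clique :: "'a pair_pre_digraph \<Rightarrow> 'a pair_pre_digraph \<Rightarrow> bool" where
  "nontrivial_clique C H \<longleftrightarrow>
     subgraph (with_proj C) (with_proj H) \<and>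
     complete_digraph (card (pverts C)) (with_proj C) \<and>
     card (pverts C) \<ge> 2"

text \<open>
  Cliques are symmetric, so the two arcs of an undirected edge lie in the same members of \<open>D\<close>.
\<close>

definition clique_decomposition ::
    "'a pair_pre_digraph set \<Rightarrow> 'a pair_pre_digraph \<Rightarrow> bool" where
  "clique_decomposition D H \<longleftrightarrow>
     (\<forall>C\<in>D. nontrivial_clique C H) \<and>
     (\<forall>e\<in>parcs H. \<exists>!C. C \<in> D \<and> e \<in> parcs C)"

definition derangement_representation ::
    "nat \<Rightarrow> 'a pair_pre_digraph \<Rightarrow> ('a \<Rightarrow> nat \<Rightarrow> nat) \<Rightarrow> bool" where
  "derangement_representation k G \<pi> \<longleftrightarrow>
     (\<forall>v\<in>pverts G. \<pi> v permutes {1..k}) \<and>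
     inj_on \<pi> (pverts G) \<and>
     (\<forall>u\<in>pverts G. \<forall>v\<in>pverts G. u \<noteq> v \<longrightarrow>
        ((u, v) \<in> parcs G \<longleftrightarrow> (\<forall>i\<in>{1..k}. \<pi> v i \<noteq> \<pi> u i)))"

definition derangement_representable :: "nat \<Rightarrow> 'a pair_pre_digraph \<Rightarrow> bool" where
  "derangement_representable k G \<longleftrightarrow> k \<ge> 1 \<and> (\<exists>\<pi>. derangement_representation k G \<pi>)"

text \<open>
  The value of \<open>drn G\<close> is meaningful only if \<open>derangement_representable k G\<close> holds for some \<open>k\<close>;
  an upper bound on \<open>drn G\<close> should therefore be accompanied by this existence claim.
\<close>

definition drn :: "'a pair_pre_digraph \<Rightarrow> nat" where
  "drn G = (LEAST k. derangement_representable k G)"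

end

theory Submission
  imports Defs "HOL-Number_Theory.Cong"
begin

text \<open>
  Each clique \<open>C\<close> of the decomposition gives a colouring of the vertices that paints \<open>C\<close> in one
  colour and every other vertex in a colour of its own, so with \<open>n + 1 - p(C)\<close> colours
  (\<open>collapsing_colouring\<close>). Two distinct vertices share a colour in one of these colourings iff
  they lie in a common clique, that is, iff they are not adjacent in \<open>G\<close>.

  Colourings turn into permutations because two cyclic shifts of \<open>\<int>/m\<close> agree everywhere if their
  amounts are equal and nowhere otherwise. So reserve for \<open>C\<close> a block of \<open>n + 1 - p(C)\<close> points,
  and let the permutation of \<open>v\<close> rotate this block by the colour of \<open>v\<close>
  (\<open>representable_by_colourings\<close>). The permutations of \<open>u\<close> and \<open>v\<close> then agree somewhere iff some
  colouring paints \<open>u\<close> and \<open>v\<close> alike, and the number of points is the bound claimed.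

  The hypothesis \<open>s \<ge> 2\<close> makes the representation injective: equal permutations of distinct
  vertices would place both in two different cliques, and the edge between them would then be
  covered twice.
\<close>

section \<open>Permutations from colourings\<close>

definition block_shift :: "('i \<Rightarrow> nat) \<Rightarrow> ('i \<Rightarrow> nat) \<Rightarrow> 'i \<times> nat \<Rightarrow> 'i \<times> nat" where
  "block_shift m a = (\<lambda>(i, j). (i, (j + a i) mod m i))"

lemma block_shift_eq_iff:
  assumes "j < m i" "a i < m i" "b i < m i"
  shows "block_shift m a (i, j) = block_shift m b (i, j) \<longleftrightarrow> a i = b i"
proof
  assume "block_shift m a (i, j) = block_shift m b (i, j)"
  then have "[j + a i = j + b i] (mod m i)"
    using assms(1) by (simp add: block_shift_def cong_def)
  then have "[a i = b i] (mod m i)"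
    by (simp only: cong_add_lcancel_nat)
  then show "a i = b i"
    using assms(2,3) by (rule cong_less_modulus_unique_nat)
qed (simp add: block_shift_def)

lemma block_shift_permutes:
  fixes m :: "'i \<Rightarrow> nat"
  assumes "finite I"
  defines "S \<equiv> SIGMA i:I. {..<m i}"
  shows "(\<lambda>x. if x \<in> S then block_shift m a x else x) permutes S"
proof -
  have inj: "inj_on (block_shift m a) S"
  proof (rule inj_onI)
    fix x y assume "x \<in> S" "y \<in> S" and eq: "block_shift m a x = block_shift m a y"
    then obtain i j j' where x: "x = (i, j)" "j < m i" and y: "y = (i, j')" "j' < m i"
      by (auto simp: S_def block_shift_def)
    have "[j + a i = j' + a i] (mod m i)"
      using eq x y by (simp add: block_shift_def cong_def)
    then have "[j = j'] (mod m i)"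
      by (simp only: cong_add_rcancel_nat)
    then have "j = j'"
      using x(2) y(2) by (rule cong_less_modulus_unique_nat)
    then show "x = y"
      using x y by simp
  qed
  have "block_shift m a ` S \<subseteq> S"
    by (auto simp: S_def block_shift_def)
  moreover have "finite S"
    using assms by simp
  ultimately have "bij_betw (block_shift m a) S S"
    using inj by (simp add: bij_betw_def endo_inj_surj)
  then have "bij_betw (\<lambda>x. if x \<in> S then block_shift m a x else x) S S"
    by (rule bij_betw_cong[THEN iffD1, rotated]) simp
  then show ?thesis
    by (rule bij_imp_permutes) simp
qed

text \<open>
  The set \<open>{1..k}\<close> is only a carrier of size \<open>k\<close>: conjugation with a bijection keeps the places
  where two permutations agree.
\<close>

lemma derangement_representable_transfer:
  assumes "finite S" and "card S \<ge> 1"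
    and perm: "\<And>v. v \<in> pverts G \<Longrightarrow> \<sigma> v permutes S"
    and inj: "inj_on \<sigma> (pverts G)"
    and adj: "\<And>u v. \<lbrakk>u \<in> pverts G; v \<in> pverts G; u \<noteq> v\<rbrakk> \<Longrightarrow>
      (u, v) \<in> parcs G \<longleftrightarrow> (\<forall>x\<in>S. \<sigma> v x \<noteq> \<sigma> u x)"
  shows "derangement_representable (card S) G"
proof -
  let ?K = "{1..card S}"
  obtain f where f: "bij_betw f S ?K"
    using ex_bij_betw_nat_finite_1[OF assms(1)] bij_betw_inv by blast
  define \<pi> where
    "\<pi> v = (\<lambda>i. if i \<in> ?K then f (\<sigma> v (inv_into S f i)) else i)" for v
  have perm': "\<pi> v permutes ?K" if "v \<in> pverts G" for v
    unfolding \<pi>_def using permutes_bij_inv_into[OF perm[OF that] f] .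
  have agree: "\<pi> u (f x) = \<pi> v (f x) \<longleftrightarrow> \<sigma> u x = \<sigma> v x"
    if "u \<in> pverts G" "v \<in> pverts G" "x \<in> S" for u v x
  proof -
    have "\<pi> w (f x) = f (\<sigma> w x)" for w
      using f \<open>x \<in> S\<close> by (simp add: \<pi>_def bij_betw_apply bij_betw_inv_into_left[OF f]
          del: atLeastAtMost_iff)
    moreover have "\<sigma> u x \<in> S" "\<sigma> v x \<in> S"
      using that perm by (simp_all add: permutes_in_image)
    ultimately show ?thesis
      using bij_betw_imp_inj_on[OF f] by (simp add: inj_on_eq_iff)
  qed
  have "inj_on \<pi> (pverts G)"
  proof (rule inj_onI)
    fix u v assume uv: "u \<in> pverts G" "v \<in> pverts G" and eq: "\<pi> u = \<pi> v"
    have "\<sigma> u x = \<sigma> v x" if "x \<in> S" for x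
      using agree[OF uv that] eq by simp
    moreover have "\<sigma> u x = \<sigma> v x" if "x \<notin> S" for x
      using permutes_not_in[OF perm[OF uv(1)] that] permutes_not_in[OF perm[OF uv(2)] that] by simp
    ultimately have "\<sigma> u = \<sigma> v"
      by blast
    then show "u = v"
      using inj uv by (simp add: inj_on_eq_iff)
  qed
  moreover have "(u, v) \<in> parcs G \<longleftrightarrow> (\<forall>i\<in>?K. \<pi> v i \<noteq> \<pi> u i)"
    if "u \<in> pverts G" "v \<in> pverts G" "u \<noteq> v" for u v
  proof -
    have "(\<forall>i\<in>?K. \<pi> v i \<noteq> \<pi> u i) \<longleftrightarrow> (\<forall>x\<in>S. \<pi> v (f x) \<noteq> \<pi> u (f x))"
      unfolding bij_betw_imp_surj_on[OF f, symmetric] by simp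
    also have "\<dots> \<longleftrightarrow> (\<forall>x\<in>S. \<sigma> v x \<noteq> \<sigma> u x)"
      using agree that by simp
    finally show ?thesis
      using adj that by simp
  qed
  ultimately have "derangement_representation (card S) G \<pi>"
    using perm' by (simp add: derangement_representation_def)
  then show ?thesis
    using assms(2) by (auto simp: derangement_representable_def)
qed

text \<open>
  On block \<open>i\<close> the permutations of \<open>u\<close> and \<open>v\<close> are rotations by \<open>c i u\<close> and \<open>c i v\<close>, which agree
  on the whole block or nowhere in it. So "no agreement at all" means that every colouring tells
  \<open>u\<close> from \<open>v\<close>, and "agreement everywhere" that none does; the latter is what the separation
  hypothesis rules out, to make the representation injective.
\<close>

lemma representable_by_colourings:
  assumes "finite I" and "I \<noteq> {}"
    and pos: "\<And>i. i \<in> I \<Longrightarrow> m i > 0"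
    and range: "\<And>i v. \<lbrakk>i \<in> I; v \<in> pverts G\<rbrakk> \<Longrightarrow> c i v < m i"
    and adj: "\<And>u v. \<lbrakk>u \<in> pverts G; v \<in> pverts G; u \<noteq> v\<rbrakk> \<Longrightarrow>
      (u, v) \<in> parcs G \<longleftrightarrow> (\<forall>i\<in>I. c i u \<noteq> c i v)"
    and separated: "\<And>u v. \<lbrakk>u \<in> pverts G; v \<in> pverts G; u \<noteq> v\<rbrakk> \<Longrightarrow> \<exists>i\<in>I. c i u \<noteq> c i v"
  shows "derangement_representable (\<Sum>i\<in>I. m i) G"
proof -
  define S where "S = (SIGMA i:I. {..<m i})"
  define \<sigma> where
    "\<sigma> v = (\<lambda>x. if x \<in> S then block_shift m (\<lambda>i. c i v) x else x)" for v
  have card_S: "card S = (\<Sum>i\<in>I. m i)"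
    using \<open>finite I\<close> by (simp add: S_def)
  have agree: "\<sigma> u (i, j) = \<sigma> v (i, j) \<longleftrightarrow> c i u = c i v"
    if "u \<in> pverts G" "v \<in> pverts G" "(i, j) \<in> S" for u v i j
    using that range by (simp add: \<sigma>_def S_def block_shift_eq_iff)
  have first: "(i, 0) \<in> S" if "i \<in> I" for i
    using that pos by (simp add: S_def)
  have "derangement_representable (card S) G"
  proof (rule derangement_representable_transfer)
    show "finite S"
      using \<open>finite I\<close> by (simp add: S_def)
    then show "card S \<ge> 1"
      using \<open>I \<noteq> {}\<close> first by (auto simp: Suc_le_eq card_gt_0_iff)
    show "\<sigma> v permutes S" for v
      unfolding \<sigma>_def S_def by (rule block_shift_permutes[OF \<open>finite I\<close>])
    show "inj_on \<sigma> (pverts G)"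
    proof (rule inj_onI, rule ccontr)
      fix u v assume uv: "u \<in> pverts G" "v \<in> pverts G" "u \<noteq> v" and eq: "\<sigma> u = \<sigma> v"
      obtain i where "i \<in> I" "c i u \<noteq> c i v"
        using separated[OF uv] by blast
      then show False
        using agree[OF uv(1,2) first] eq by simp
    qed
    show "(u, v) \<in> parcs G \<longleftrightarrow> (\<forall>x\<in>S. \<sigma> v x \<noteq> \<sigma> u x)"
      if uv: "u \<in> pverts G" "v \<in> pverts G" "u \<noteq> v" for u v
    proof -
      have "(\<forall>x\<in>S. \<sigma> v x \<noteq> \<sigma> u x) \<longleftrightarrow> (\<forall>i\<in>I. c i v \<noteq> c i u)"
        using agree[OF uv(2,1)] first by (fastforce simp: S_def)
      then show ?thesis
        using adj[OF uv] by auto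
    qed
  qed
  then show ?thesis
    by (simp add: card_S)
qed

section \<open>Colourings from cliques\<close>

text \<open>
  Colour \<open>0\<close> is kept for \<open>A\<close>, which is why there is one colour more than vertices outside \<open>A\<close>.
\<close>

lemma collapsing_colouring:
  assumes "finite V" "A \<subseteq> V"
  obtains c :: "'a \<Rightarrow> nat" where
    "\<And>v. v \<in> V \<Longrightarrow> c v < card V + 1 - card A"
    "\<And>u v. \<lbrakk>u \<in> V; v \<in> V\<rbrakk> \<Longrightarrow> c u = c v \<longleftrightarrow> u = v \<or> u \<in> A \<and> v \<in> A"
proof -
  have "finite (V - A)"
    using assms by simp
  then obtain f where f: "bij_betw f (V - A) {1..card (V - A)}"
    using ex_bij_betw_nat_finite_1 bij_betw_inv by blast
  have card: "card (V - A) = card V - card A" "card A \<le> card V"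
    using assms by (simp_all add: card_Diff_subset finite_subset card_mono)
  define c where "c v = (if v \<in> A then 0 else f v)" for v
  have f_range: "1 \<le> f v" "f v \<le> card V - card A" if "v \<in> V - A" for v
    using bij_betw_apply[OF f that] card by auto
  show thesis
  proof
    show "c v < card V + 1 - card A" if "v \<in> V" for v
      using that f_range(2)[of v] card(2) by (cases "v \<in> A") (simp_all add: c_def)
    show "c u = c v \<longleftrightarrow> u = v \<or> u \<in> A \<and> v \<in> A" if "u \<in> V" "v \<in> V" for u v
      using that f_range(1)[of u] f_range(1)[of v]
        inj_on_eq_iff[OF bij_betw_imp_inj_on[OF f], of u v]
      by (cases "u \<in> A"; cases "v \<in> A") (auto simp: c_def)
  qed
qed

lemma nontrivial_clique_pverts_subset:
  assumes "nontrivial_clique C H"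
  shows "pverts C \<subseteq> pverts H"
  using assms by (simp add: nontrivial_clique_def subgraph_def)

lemma nontrivial_clique_parcs_subset:
  assumes "nontrivial_clique C H"
  shows "parcs C \<subseteq> parcs H"
  using assms by (simp add: nontrivial_clique_def subgraph_def)

lemma nontrivial_clique_parcs:
  assumes "nontrivial_clique C H"
  shows "(u, v) \<in> parcs C \<longleftrightarrow> u \<in> pverts C \<and> v \<in> pverts C \<and> u \<noteq> v"
proof -
  have "parcs C = {(u, v). (u, v) \<in> pverts C \<times> pverts C \<and> u \<noteq> v}"
    using assms unfolding nontrivial_clique_def complete_digraph_def with_proj_simps by blast
  then show ?thesis
    by simp
qed

lemma clique_decomposition_arc_iff:
  assumes D: "clique_decomposition D H" and "u \<noteq> v"
  shows "(u, v) \<in> parcs H \<longleftrightarrow> (\<exists>C\<in>D. u \<in> pverts C \<and> v \<in> pverts C)"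
proof
  assume "(u, v) \<in> parcs H"
  then obtain C where C: "C \<in> D" "(u, v) \<in> parcs C"
    using D unfolding clique_decomposition_def by blast
  then have "nontrivial_clique C H"
    using D by (simp add: clique_decomposition_def)
  then show "\<exists>C\<in>D. u \<in> pverts C \<and> v \<in> pverts C"
    using C by (auto simp: nontrivial_clique_parcs)
next
  assume "\<exists>C\<in>D. u \<in> pverts C \<and> v \<in> pverts C"
  then obtain C where "C \<in> D" "u \<in> pverts C" "v \<in> pverts C"
    by blast
  moreover have clique: "nontrivial_clique C H"
    using D \<open>C \<in> D\<close> by (simp add: clique_decomposition_def)
  ultimately have "(u, v) \<in> parcs C"
    using \<open>u \<noteq> v\<close> by (simp add: nontrivial_clique_parcs)
  then show "(u, v) \<in> parcs H"
    using nontrivial_clique_parcs_subset[OF clique] by blast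
qed

lemma clique_decomposition_common_pair:
  assumes D: "clique_decomposition D H"
    and C: "C \<in> D" "u \<in> pverts C" "v \<in> pverts C"
    and C': "C' \<in> D" "u \<in> pverts C'" "v \<in> pverts C'"
    and "u \<noteq> v"
  shows "C = C'"
proof -
  have "nontrivial_clique C H" "nontrivial_clique C' H"
    using D C(1) C'(1) by (simp_all add: clique_decomposition_def)
  then have arcs: "(u, v) \<in> parcs C" "(u, v) \<in> parcs C'"
    using C C' \<open>u \<noteq> v\<close> by (simp_all add: nontrivial_clique_parcs)
  have "(u, v) \<in> parcs H"
    using clique_decomposition_arc_iff[OF D \<open>u \<noteq> v\<close>] C by blast
  then have "\<exists>!C. C \<in> D \<and> (u, v) \<in> parcs C"
    using D by (simp add: clique_decomposition_def)
  then show ?thesis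
    using C(1) C'(1) arcs by blast
qed

section \<open>The bound\<close>

theorem theorem5:
  fixes G :: "'a pair_pre_digraph"
    and D :: "'a pair_pre_digraph set"
    and n s :: nat
  assumes "pair_graph G"
    and "card (pverts G) = n"
    and "clique_decomposition D (graph_complement G)"
    and "card D = s"
    and "s \<ge> 2"
  shows "(\<exists>k. derangement_representable k G) \<and>
    int (drn G) \<le> int s * (int n + 1) - (\<Sum>C\<in>D. int (card (pverts C)))"
proof -
  interpret pair_graph G by fact
  note D = assms(3)
  have "finite D" "D \<noteq> {}"
    using assms(4,5) by (auto intro: card_ge_0_finite)
  have sub: "pverts C \<subseteq> pverts G" if "C \<in> D" for C
    using D that nontrivial_clique_pverts_subset
    by (fastforce simp: clique_decomposition_def graph_complement_def)
  then have le: "card (pverts C) \<le> n" if "C \<in> D" for C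
    using that card_mono[OF finite_verts, of "pverts C"] assms(2) by simp
  define m where "m C = n + 1 - card (pverts C)" for C :: "'a pair_pre_digraph"
  have "\<exists>c. (\<forall>v\<in>pverts G. c v < m C) \<and>
      (\<forall>u\<in>pverts G. \<forall>v\<in>pverts G. c u = c v \<longleftrightarrow> u = v \<or> u \<in> pverts C \<and> v \<in> pverts C)"
    if "C \<in> D" for C
  proof -
    have "finite (pverts G)" "pverts C \<subseteq> pverts G"
      using finite_verts sub[OF that] by simp_all
    then obtain c where "\<And>v. v \<in> pverts G \<Longrightarrow> c v < m C"
      "\<And>u v. \<lbrakk>u \<in> pverts G; v \<in> pverts G\<rbrakk> \<Longrightarrow> c u = c v \<longleftrightarrow> u = v \<or> u \<in> pverts C \<and> v \<in> pverts C"
      using collapsing_colouring[of "pverts G" "pverts C"] unfolding m_def assms(2) by blast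
    then show ?thesis
      by blast
  qed
  then obtain c :: "'a pair_pre_digraph \<Rightarrow> 'a \<Rightarrow> nat" where
    range: "\<And>C v. \<lbrakk>C \<in> D; v \<in> pverts G\<rbrakk> \<Longrightarrow> c C v < m C" and
    eq: "\<And>C u v. \<lbrakk>C \<in> D; u \<in> pverts G; v \<in> pverts G\<rbrakk> \<Longrightarrow>
      c C u = c C v \<longleftrightarrow> u = v \<or> u \<in> pverts C \<and> v \<in> pverts C"
    by metis
  have rep: "derangement_representable (\<Sum>C\<in>D. m C) G"
  proof (rule representable_by_colourings[of D m G c])
    show "m C > 0" if "C \<in> D" for C
      using le[OF that] by (simp add: m_def)
    fix u v assume uv: "u \<in> pverts G" "v \<in> pverts G" "u \<noteq> v"
    have "(u, v) \<in> parcs G \<longleftrightarrow> (u, v) \<notin> parcs (graph_complement G)"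
      using uv by (simp add: graph_complement_def)
    also have "\<dots> \<longleftrightarrow> (\<forall>C\<in>D. c C u \<noteq> c C v)"
      using clique_decomposition_arc_iff[OF D uv(3)] eq uv by simp
    finally show "(u, v) \<in> parcs G \<longleftrightarrow> (\<forall>C\<in>D. c C u \<noteq> c C v)" .
    show "\<exists>C\<in>D. c C u \<noteq> c C v"
    proof (rule ccontr)
      assume "\<not> (\<exists>C\<in>D. c C u \<noteq> c C v)"
      then have "u \<in> pverts C \<and> v \<in> pverts C" if "C \<in> D" for C
        using that eq uv by blast
      then have "C = C'" if "C \<in> D" "C' \<in> D" for C C'
        using that clique_decomposition_common_pair[OF D _ _ _ _ _ _ uv(3)] by simp
      then have "card D \<le> 1"
        using card_le_Suc0_iff_eq[OF \<open>finite D\<close>] by auto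
      then show False
        using assms(4,5) by simp
    qed
  qed (use \<open>finite D\<close> \<open>D \<noteq> {}\<close> range in auto)
  then have "drn G \<le> (\<Sum>C\<in>D. m C)"
    unfolding drn_def by (rule Least_le)
  then have "int (drn G) \<le> (\<Sum>C\<in>D. int (m C))"
    by (metis of_nat_le_iff of_nat_sum)
  also have "\<dots> = (\<Sum>C\<in>D. (int n + 1) - int (card (pverts C)))"
  proof (rule sum.cong)
    show "int (m C) = (int n + 1) - int (card (pverts C))" if "C \<in> D" for C
      unfolding m_def using le[OF that] by linarith
  qed simp
  also have "\<dots> = int s * (int n + 1) - (\<Sum>C\<in>D. int (card (pverts C)))"
    using assms(4) by (simp add: sum_subtractf)
  finally show ?thesis
    using rep by blast
qed

end
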